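(* Let $\pi=(\pi_i)_{1\le i\le m}$ be a probability distribution with $\pi_i>0$ for all $i$. For each $n\ge 1$ let $U^{[n]}=(U^{[n]}_{ij})_{1\le i,j\le m}$ be a unitary matrix and let $\chi^{[n]}=(\chi^{[n]}_i(k))_{1\le i\le m,\,1\le k\le d}$ be a complex matrix with $\sum_{k}|\chi^{[n]}_i(k)|^2=1$ for every $i$. Consider the entangled hidden Markov model (EHMM) given by $\pi$ and the maps $V_H^{[n]}:e_i\mapsto\sum_j U^{[n]}_{ij}\,e_i\otimes e_j$ and $V_O^{[n]}:e_i\mapsto\sum_k\chi_i^{[n]}(k)\,e_i\otimes|k\rangle$, with state vectors $|\Psi_{H,O;n}\rangle\in\mathcal H^{\otimes(n+1)}\otimes\mathcal K^{\otimes n}$. Define $m\times m$ matrices $A^{[n]}_k=(a^{[n]}_{k;ij})_{i,j}$ by $$a^{[n]}_{k;ij}=U^{[n]}_{ij}\,\chi^{[n]}_i(k).$$ For integers $n\ge N\ge 1$ define $E_{N,n}\in\mathcal H^{\otimes(n+1)}\otimes\mathcal K^{\otimes(n-N)}$ by $$E_{N,n}=\sum_{i_1,\dots,i_{n+1}}\ \sum_{k_{N+1},\dots,k_n}\frac{1}{\sqrt{\pi_{i_1}}}\Big(\prod_{\ell=N+1}^{n}U^{[\ell]}_{i_\ell i_{\ell+1}}\chi^{[\ell]}_{i_\ell}(k_\ell)\Big)\,\delta_{i_{N+1},i_1}\;e_{i_1}\otimes\cdots\otimes e_{i_{n+1}}\otimes|k_{N+1}\cdots k_n\rangle .$$ Then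 for every $N\ge1$ and every $n\ge N$, $$\big\langle\Psi_{H,O;n}\,\big|\,E_{N,n}\big\rangle_{\mathcal H^{\otimes(n+1)}\otimes\mathcal K^{\otimes(n-N)}}=\sum_{k_1,\dots,k_N}\mathrm{Tr}\big(A^{[1]}_{k_1}\cdots A^{[N]}_{k_N}\big)\,|k_1\cdots k_N\rangle\in\mathcal K^{\otimes N}.$$ Moreover, for every $n\ge 1$ the gauge condition $\sum_{k=1}^d A^{[n]}_kA^{[n]\dagger}_k=\mathbf 1_m$ holds.
   Context: $\mathcal H$ is a complex Hilbert space of dimension $m$ with orthonormal basis $(e_i)_{1\le i\le m}$ and $\mathcal K$ is a complex Hilbert space of dimension $d$ with orthonormal basis $(|k\rangle)_{1\le k\le d}$. Write $|k_1\cdots k_N\rangle=|k_1\rangle\otimes\cdots\otimes|k_N\rangle$; indices $i_\ell$ run over $\{1,\dots,m\}$ and $k_\ell$ over $\{1,\dots,d\}$. By convention $\mathcal K^{\otimes 0}=\mathbb C$, empty products are $1$, and $\mathbf 1_m$ is the $m\times m$ identity matrix. EHMM state vector: $$|\Psi_{H,O;n}\rangle=\sum_{i_1,\dots,i_{n+1}}\sum_{k_1,\dots,k_n}\sqrt{\pi_{i_1}}\Big(\prod_{\ell=1}^nU^{[\ell]}_{i_\ell i_{\ell+1}}\chi^{[\ell]}_{i_\ell}(k_\ell)\Big)\,e_{i_1}\otimes\cdots\otimes e_{i_{n+1}}\otimes|k_1\cdots k_n\rangle .$$ Partial inner product: for Hilbert spaces $\mathcal U,\mathcal V$ and a fixed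 vector $u_0\in\mathcal U$, the linear map $\langle\,\cdot\mid u_0\rangle_{\mathcal U}:\mathcal U\otimes\mathcal V\to\mathcal V$ is given by $\sum_r u_r\otimes v_r\mapsto\sum_r\langle u_r,u_0\rangle_{\mathcal U}\,v_r$, where the inner product is linear in its first argument and conjugate-linear in its second. In the claim, $\mathcal U=\mathcal H^{\otimes(n+1)}\otimes\mathcal K^{\otimes(n-N)}$, where $\mathcal K^{\otimes(n-N)}$ consists of the last $n-N$ factors of $\mathcal K^{\otimes n}$ (sites $N+1,\dots,n$), and $\mathcal V=\mathcal K^{\otimes N}$ consists of the first $N$ factors. *)

theory Defs
  imports "HOL-Analysis.Analysis" "HOL-Library.Poly_Mapping"
begin

text \<open>
  The type \<open>'a \<Rightarrow>\<^sub>0 complex\<close> is the complex vector space with distinguished orthonormal basis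
  \<open>ket x\<close> (x of type 'a); for a finite type it has dimension \<open>CARD('a)\<close>.  So \<open>'m \<Rightarrow>\<^sub>0 complex\<close> is
  \<open>\<H>\<close> (with \<open>e\<^sub>i = ket i\<close>) and \<open>'d \<Rightarrow>\<^sub>0 complex\<close> is \<open>\<K>\<close>.

  The tensor product of the spaces with bases 'a and 'b has basis \<open>'a \<times> 'b\<close>.  The n-th tensor
  power of the space with basis 'a has as basis the lists of length n: the vector \<open>ket [x\<^sub>1, \<dots>, x\<^sub>n]\<close>
  stands for \<open>ket x\<^sub>1 \<otimes> \<dots> \<otimes> ket x\<^sub>n\<close>, and \<open>ket []\<close> spans the 0-th power, a copy of the
  scalars.  All tensor powers live in the one type \<open>'a list \<Rightarrow>\<^sub>0 complex\<close>, in which they are the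
  homogeneous components \<open>tensor_power n\<close>.
\<close>

definition scale :: "complex \<Rightarrow> ('a \<Rightarrow>\<^sub>0 complex) \<Rightarrow> ('a \<Rightarrow>\<^sub>0 complex)"  (infixr "\<cdot>\<^sub>C" 75)
  where "c \<cdot>\<^sub>C v = Poly_Mapping.map (\<lambda>z. c * z) v"

definition ket :: "'a \<Rightarrow> ('a \<Rightarrow>\<^sub>0 complex)"
  where "ket x = Poly_Mapping.single x 1"

definition lin_ext :: "('a \<Rightarrow> ('b \<Rightarrow>\<^sub>0 complex)) \<Rightarrow> ('a \<Rightarrow>\<^sub>0 complex) \<Rightarrow> ('b \<Rightarrow>\<^sub>0 complex)"
  where "lin_ext f v = (\<Sum>x\<in>Poly_Mapping.keys v. Poly_Mapping.lookup v x \<cdot>\<^sub>C f x)"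

definition tensor :: "('a \<Rightarrow>\<^sub>0 complex) \<Rightarrow> ('b \<Rightarrow>\<^sub>0 complex) \<Rightarrow> ('a \<times> 'b \<Rightarrow>\<^sub>0 complex)"
    (infixr "\<otimes>\<^sub>C" 80)
  where "u \<otimes>\<^sub>C v = lin_ext (\<lambda>x. lin_ext (\<lambda>y. ket (x, y)) v) u"

definition tensor_power :: "nat \<Rightarrow> ('a list \<Rightarrow>\<^sub>0 complex) set"
  where "tensor_power n = {v. \<forall>xs\<in>Poly_Mapping.keys v. length xs = n}"

text \<open>The inner product is linear in its first and conjugate-linear in its second argument.\<close>

definition cinner :: "('a \<Rightarrow>\<^sub>0 complex) \<Rightarrow> ('a \<Rightarrow>\<^sub>0 complex) \<Rightarrow> complex"
  where "cinner u v = (\<Sum>x\<in>Poly_Mapping.keys u.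
           Poly_Mapping.lookup u x * cnj (Poly_Mapping.lookup v x))"

text \<open>
  \<open>partial_inner w u\<^sub>0\<close> contracts the left factor of \<open>w\<close> with \<open>u\<^sub>0\<close>.  It is given here on the
  product basis; \<open>partial_inner_tensor_sum\<close> below is its basis-free description.
\<close>

definition partial_inner ::
    "('a \<times> 'b \<Rightarrow>\<^sub>0 complex) \<Rightarrow> ('a \<Rightarrow>\<^sub>0 complex) \<Rightarrow> ('b \<Rightarrow>\<^sub>0 complex)"
  where "partial_inner w u\<^sub>0 = lin_ext (\<lambda>(x, y). cinner (ket x) u\<^sub>0 \<cdot>\<^sub>C ket y) w"

text \<open>
  The identification of \<open>\<H>\<^bsup>\<otimes>(n+1)\<^esup> \<otimes> \<K>\<^bsup>\<otimes>n\<^esup>\<close> with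
  \<open>(\<H>\<^bsup>\<otimes>(n+1)\<^esup> \<otimes> \<K>\<^bsup>\<otimes>(n-N)\<^esup>) \<otimes> \<K>\<^bsup>\<otimes>N\<^esup>\<close>: the first N of the
  \<open>\<K>\<close>-factors become the right factor, the remaining ones stay with \<open>\<H>\<^bsup>\<otimes>(n+1)\<^esup>\<close>.
\<close>

definition split_sites ::
    "nat \<Rightarrow> ('h \<times> 'k list \<Rightarrow>\<^sub>0 complex) \<Rightarrow> (('h \<times> 'k list) \<times> 'k list \<Rightarrow>\<^sub>0 complex)"
  where "split_sites N =
    lin_ext (\<lambda>(h, ks). (ket h \<otimes>\<^sub>C ket (drop N ks)) \<otimes>\<^sub>C ket (take N ks))"

definition adjoint_matrix :: "complex^'m^'n \<Rightarrow> complex^'n^'m"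
  where "adjoint_matrix M = (\<chi> i j. cnj (M $ j $ i))"

definition unitary_matrix :: "complex^'m^'m \<Rightarrow> bool"
  where "unitary_matrix M \<longleftrightarrow>
    adjoint_matrix M ** M = mat 1 \<and> M ** adjoint_matrix M = mat 1"

definition hidden_map ::
    "complex^'m^'m \<Rightarrow> ('m::finite \<Rightarrow>\<^sub>0 complex) \<Rightarrow> ('m \<times> 'm \<Rightarrow>\<^sub>0 complex)"
  where "hidden_map M = lin_ext (\<lambda>i. \<Sum>j\<in>UNIV. M $ i $ j \<cdot>\<^sub>C (ket i \<otimes>\<^sub>C ket j))"

definition observation_map ::
    "complex^'d^'m \<Rightarrow> ('m::finite \<Rightarrow>\<^sub>0 complex) \<Rightarrow> ('m \<times> 'd::finite \<Rightarrow>\<^sub>0 complex)"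
  where "observation_map C = lin_ext (\<lambda>i. \<Sum>k\<in>UNIV. C $ i $ k \<cdot>\<^sub>C (ket i \<otimes>\<^sub>C ket k))"

text \<open>
  Lists are indexed from 0: \<open>i\<^sub>l\<close> is \<open>is ! (l - 1)\<close>, and \<open>i\<^sub>l\<^sub>+\<^sub>1\<close> is \<open>is ! l\<close>.  The matrices
  \<open>U l\<close>, \<open>C l\<close> are only ever used for \<open>l \<ge> 1\<close>.
\<close>

definition ehmm_state ::
    "('m::finite \<Rightarrow> real) \<Rightarrow> (nat \<Rightarrow> complex^'m^'m) \<Rightarrow> (nat \<Rightarrow> complex^'d^'m) \<Rightarrow> nat \<Rightarrow>
     ('m list \<times> 'd::finite list \<Rightarrow>\<^sub>0 complex)"
  where "ehmm_state p U C n =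
    (\<Sum>is\<in>{is. length is = n + 1}. \<Sum>ks\<in>{ks. length ks = n}.
       (complex_of_real (sqrt (p (is ! 0))) *
        (\<Prod>l=1..n. U l $ (is ! (l - 1)) $ (is ! l) * C l $ (is ! (l - 1)) $ (ks ! (l - 1))))
       \<cdot>\<^sub>C (ket is \<otimes>\<^sub>C ket ks))"

definition mps_matrix ::
    "(nat \<Rightarrow> complex^'m^'m) \<Rightarrow> (nat \<Rightarrow> complex^'d^'m) \<Rightarrow> nat \<Rightarrow> 'd \<Rightarrow> complex^'m^'m"
  where "mps_matrix U C n k = (\<chi> i j. U n $ i $ j * C n $ i $ k)"

text \<open>
  In \<open>E\<^sub>N\<^sub>,\<^sub>n\<close> the list \<open>ks\<close> holds the indices of the sites \<open>N + 1, \<dots>, n\<close>, so \<open>k\<^sub>l\<close> is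
  \<open>ks ! (l - N - 1)\<close>.
\<close>

definition env_vector ::
    "('m::finite \<Rightarrow> real) \<Rightarrow> (nat \<Rightarrow> complex^'m^'m) \<Rightarrow> (nat \<Rightarrow> complex^'d^'m) \<Rightarrow> nat \<Rightarrow> nat \<Rightarrow>
     ('m list \<times> 'd::finite list \<Rightarrow>\<^sub>0 complex)"
  where "env_vector p U C N n =
    (\<Sum>is\<in>{is. length is = n + 1}. \<Sum>ks\<in>{ks. length ks = n - N}.
       (complex_of_real (1 / sqrt (p (is ! 0))) *
        (\<Prod>l=N+1..n. U l $ (is ! (l - 1)) $ (is ! l) * C l $ (is ! (l - 1)) $ (ks ! (l - N - 1))) *
        of_bool (is ! N = is ! 0))
       \<cdot>\<^sub>C (ket is \<otimes>\<^sub>C ket ks))"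

definition mps_product ::
    "(nat \<Rightarrow> complex^'m^'m) \<Rightarrow> (nat \<Rightarrow> complex^'d^'m) \<Rightarrow> nat \<Rightarrow> 'd list \<Rightarrow> complex^'m^'m"
  where "mps_product U C N ks =
    foldr (\<lambda>l M. mps_matrix U C l (ks ! (l - 1)) ** M) [1..<N+1] (mat 1)"

lemma lookup_scale [simp]:
  "Poly_Mapping.lookup (c \<cdot>\<^sub>C v) x = c * Poly_Mapping.lookup v x"
  by (auto simp: scale_def Poly_Mapping.map.rep_eq when_def)

lemma lookup_ket: "Poly_Mapping.lookup (ket x) y = of_bool (x = y)"
  by (simp add: ket_def lookup_single when_def)

lemma lookup_lin_ext:
  assumes "finite S" "Poly_Mapping.keys v \<subseteq> S"
  shows "Poly_Mapping.lookup (lin_ext f v) y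
    = (\<Sum>x\<in>S. Poly_Mapping.lookup v x * Poly_Mapping.lookup (f x) y)"
  unfolding lin_ext_def lookup_sum lookup_scale
  by (rule sum.mono_neutral_left) (use assms in \<open>auto simp: in_keys_iff\<close>)

lemma lin_ext_ket [simp]: "lin_ext f (ket x) = f x"
  by (simp add: lin_ext_def ket_def poly_mapping_eqI)

lemma lin_ext_add: "lin_ext f (v + w) = lin_ext f v + lin_ext f w"
proof (rule poly_mapping_eqI)
  fix y
  let ?S = "Poly_Mapping.keys v \<union> Poly_Mapping.keys w"
  have "finite ?S" "Poly_Mapping.keys v \<subseteq> ?S" "Poly_Mapping.keys w \<subseteq> ?S"
    "Poly_Mapping.keys (v + w) \<subseteq> ?S"
    using keys_add[of v w] by auto
  then show "Poly_Mapping.lookup (lin_ext f (v + w)) y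
      = Poly_Mapping.lookup (lin_ext f v + lin_ext f w) y"
    by (simp add: lookup_lin_ext[of ?S] lookup_add algebra_simps sum.distrib)
qed

lemma lin_ext_scale: "lin_ext f (c \<cdot>\<^sub>C v) = c \<cdot>\<^sub>C lin_ext f v"
proof (rule poly_mapping_eqI)
  fix y
  have "Poly_Mapping.keys (c \<cdot>\<^sub>C v) \<subseteq> Poly_Mapping.keys v"
    by (auto simp: in_keys_iff)
  then show "Poly_Mapping.lookup (lin_ext f (c \<cdot>\<^sub>C v)) y = Poly_Mapping.lookup (c \<cdot>\<^sub>C lin_ext f v) y"
    by (simp add: lookup_lin_ext[of "Poly_Mapping.keys v"] sum_distrib_left algebra_simps)
qed

lemma lin_ext_sum: "lin_ext f (\<Sum>r\<in>R. v r) = (\<Sum>r\<in>R. lin_ext f (v r))"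
  by (induction R rule: infinite_finite_induct) (simp_all add: lin_ext_add lin_ext_def[of f 0])

lemma of_bool_mult_if:
  "of_bool P * z = (if P then z else 0)" "z * of_bool P = (if P then z else 0)" for z :: complex
  by simp_all

lemma lookup_tensor:
  "Poly_Mapping.lookup (u \<otimes>\<^sub>C v) (x, y) = Poly_Mapping.lookup u x * Poly_Mapping.lookup v y"
proof -
  have *: "Poly_Mapping.lookup (lin_ext (\<lambda>y. ket (x', y)) v) (x, y)
      = of_bool (x' = x) * Poly_Mapping.lookup v y" for x'
    by (auto simp: lookup_lin_ext[of "insert y (Poly_Mapping.keys v)"] subset_insertI lookup_ket
        of_bool_mult_if)
  show ?thesis
    unfolding tensor_def
    by (auto simp: lookup_lin_ext[of "insert x (Poly_Mapping.keys u)"] subset_insertI *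
        of_bool_mult_if if_distrib[of "\<lambda>z. _ * z"] cong: if_cong)
qed

lemma tensor_ket_ket: "ket x \<otimes>\<^sub>C ket y = ket (x, y)"
  by (simp add: tensor_def)

lemma tensor_sum_kets:
  "u \<otimes>\<^sub>C v = (\<Sum>x\<in>Poly_Mapping.keys u. \<Sum>y\<in>Poly_Mapping.keys v.
     (Poly_Mapping.lookup u x * Poly_Mapping.lookup v y) \<cdot>\<^sub>C ket (x, y))"
  by (rule poly_mapping_eqI)
    (simp add: tensor_def lin_ext_def lookup_sum sum_distrib_left mult.assoc)

lemma partial_inner_tensor: "partial_inner (u \<otimes>\<^sub>C v) u\<^sub>0 = cinner u u\<^sub>0 \<cdot>\<^sub>C v"
proof (rule poly_mapping_eqI)
  fix z
  have c: "cinner (ket x) u\<^sub>0 = cnj (Poly_Mapping.lookup u\<^sub>0 x)" for x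
    by (simp add: cinner_def ket_def)
  have v: "(\<Sum>y\<in>Poly_Mapping.keys v. Poly_Mapping.lookup v y * of_bool (y = z))
      = Poly_Mapping.lookup v z"
    by (auto simp: of_bool_def if_distrib in_keys_iff cong: if_cong)
  have "Poly_Mapping.lookup (partial_inner (u \<otimes>\<^sub>C v) u\<^sub>0) z
      = (\<Sum>x\<in>Poly_Mapping.keys u. \<Sum>y\<in>Poly_Mapping.keys v.
          (Poly_Mapping.lookup u x * cnj (Poly_Mapping.lookup u\<^sub>0 x)) *
          (Poly_Mapping.lookup v y * of_bool (y = z)))"
    by (simp add: partial_inner_def tensor_sum_kets lin_ext_sum lin_ext_scale lookup_sum c
        lookup_ket algebra_simps)
  also have "\<dots> = Poly_Mapping.lookup (cinner u u\<^sub>0 \<cdot>\<^sub>C v) z"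
    by (simp add: v cinner_def sum_distrib_right flip: sum_distrib_left)
  finally show "Poly_Mapping.lookup (partial_inner (u \<otimes>\<^sub>C v) u\<^sub>0) z
      = Poly_Mapping.lookup (cinner u u\<^sub>0 \<cdot>\<^sub>C v) z" .
qed

theorem partial_inner_tensor_sum:
  "partial_inner (\<Sum>r\<in>R. u r \<otimes>\<^sub>C v r) u\<^sub>0 = (\<Sum>r\<in>R. cinner (u r) u\<^sub>0 \<cdot>\<^sub>C v r)"
  unfolding partial_inner_tensor[symmetric] by (simp add: partial_inner_def lin_ext_sum)

lemma split_sites_ket:
  assumes "length ks = N"
  shows "split_sites N (ket h \<otimes>\<^sub>C ket (ks @ ks')) = (ket h \<otimes>\<^sub>C ket ks') \<otimes>\<^sub>C ket ks"
  using assms by (simp add: split_sites_def tensor_ket_ket)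

lemma finite_lists_of_length [simp]: "finite {xs :: 'a::finite list. length xs = n}"
  using finite_lists_length_eq[of "UNIV :: 'a set" n] by simp

lemma lookup_sum_tensor_kets:
  fixes f :: "'m::finite list \<Rightarrow> 'd::finite list \<Rightarrow> complex"
  shows "Poly_Mapping.lookup
      (\<Sum>is\<in>{is. length is = a}. \<Sum>ks\<in>{ks. length ks = b}. f is ks \<cdot>\<^sub>C (ket is \<otimes>\<^sub>C ket ks)) (xs, ys)
    = (if length xs = a \<and> length ys = b then f xs ys else 0)"
proof -
  have "Poly_Mapping.lookup
      (\<Sum>is\<in>{is. length is = a}. \<Sum>ks\<in>{ks. length ks = b}. f is ks \<cdot>\<^sub>C (ket is \<otimes>\<^sub>C ket ks)) (xs, ys)
    = (\<Sum>is\<in>{is. length is = a}. if is = xs then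
        (\<Sum>ks\<in>{ks. length ks = b}. if ks = ys then f is ks else 0) else 0)"
    unfolding lookup_sum lookup_scale lookup_tensor lookup_ket
    by (intro sum.cong refl) (auto intro!: sum.neutral sum.cong)
  then show ?thesis
    by simp
qed

lemma lookup_ehmm_state:
  "Poly_Mapping.lookup (ehmm_state p U C n) (is, ks) =
    (if length is = n + 1 \<and> length ks = n then
       complex_of_real (sqrt (p (is ! 0))) *
       (\<Prod>l=1..n. U l $ (is ! (l - 1)) $ (is ! l) * C l $ (is ! (l - 1)) $ (ks ! (l - 1)))
     else 0)"
  unfolding ehmm_state_def by (rule lookup_sum_tensor_kets)

text \<open>
  The state vectors are generated by the two maps: starting from \<open>\<Sum>\<^sub>i \<surd>p\<^sub>i e\<^sub>i\<close>, the hidden map is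
  applied to the last \<open>\<H>\<close>-factor and then the observation map to the first of its two outputs.
\<close>

lemma ehmm_state_0:
  fixes p :: "'m::finite \<Rightarrow> real" and C :: "nat \<Rightarrow> complex^'d::finite^'m"
  shows "ehmm_state p U C 0 = (\<Sum>i\<in>UNIV. complex_of_real (sqrt (p i)) \<cdot>\<^sub>C (ket [i] \<otimes>\<^sub>C ket []))"
proof -
  have "{is :: 'm list. length is = 1} = range (\<lambda>i. [i])"
    by (auto simp: length_Suc_conv)
  moreover have "inj (\<lambda>i :: 'm. [i])"
    by (simp add: inj_on_def)
  ultimately show ?thesis
    by (simp add: ehmm_state_def sum.reindex)
qed

lemma lookup_hidden_map:
  "Poly_Mapping.lookup (hidden_map M (ket h)) (h', j) = of_bool (h = h') * M $ h $ j"
  by (auto simp: hidden_map_def lookup_sum lookup_tensor lookup_ket if_distrib of_bool_def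
      cong: if_cong)

lemma lookup_observation_map:
  "Poly_Mapping.lookup (observation_map C (ket h)) (i, k) = of_bool (h = i) * C $ h $ k"
  by (auto simp: observation_map_def lookup_sum lookup_tensor lookup_ket if_distrib of_bool_def
      cong: if_cong)

lemma ehmm_state_Suc:
  assumes "length is = n" "length ks = n"
  shows "Poly_Mapping.lookup (ehmm_state p U C (Suc n)) (is @ [i, j], ks @ [k]) =
    (\<Sum>h\<in>UNIV. \<Sum>h'\<in>UNIV.
       Poly_Mapping.lookup (ehmm_state p U C n) (is @ [h], ks) *
       Poly_Mapping.lookup (hidden_map (U (Suc n)) (ket h)) (h', j) *
       Poly_Mapping.lookup (observation_map (C (Suc n)) (ket h')) (i, k))"
proof -
  let ?\<psi> = "\<lambda>h. Poly_Mapping.lookup (ehmm_state p U C n) (is @ [h], ks)"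
  have "(\<Prod>l=1..n. U l $ ((is @ [i, j]) ! (l - 1)) $ ((is @ [i, j]) ! l) *
        C l $ ((is @ [i, j]) ! (l - 1)) $ ((ks @ [k]) ! (l - 1)))
      = (\<Prod>l=1..n. U l $ ((is @ [i]) ! (l - 1)) $ ((is @ [i]) ! l) *
        C l $ ((is @ [i]) ! (l - 1)) $ (ks ! (l - 1)))"
    using assms by (intro prod.cong) (auto simp: nth_append)
  moreover have "(is @ [i, j]) ! 0 = (is @ [i]) ! 0"
    by (cases "is") auto
  ultimately have "Poly_Mapping.lookup (ehmm_state p U C (Suc n)) (is @ [i, j], ks @ [k])
      = ?\<psi> i * (U (Suc n) $ i $ j * C (Suc n) $ i $ k)"
    using assms by (simp add: lookup_ehmm_state nth_append)
  also have "\<dots> = (\<Sum>h\<in>UNIV. \<Sum>h'\<in>UNIV. if h' = i then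
      (if h = i then ?\<psi> i * (U (Suc n) $ i $ j * C (Suc n) $ i $ k) else 0) else 0)"
    by simp
  also have "\<dots> = (\<Sum>h\<in>UNIV. \<Sum>h'\<in>UNIV. ?\<psi> h *
       Poly_Mapping.lookup (hidden_map (U (Suc n)) (ket h)) (h', j) *
       Poly_Mapping.lookup (observation_map (C (Suc n)) (ket h')) (i, k))"
    by (intro sum.cong refl) (simp add: lookup_hidden_map lookup_observation_map)
  finally show ?thesis .
qed

end

theory Submission
  imports Defs
begin

text \<open>
  In the coefficient of \<open>|k\<^sub>1\<cdots>k\<^sub>N\<rangle>\<close> the factors \<open>\<surd>\<pi>\<close> and \<open>1/\<surd>\<pi>\<close> cancel, and the amplitudes
  of the sites \<open>N + 1, \<dots>, n\<close> meet their own conjugates.  Since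
  \<open>\<Sum>\<^sub>j\<^sub>,\<^sub>k |U\<^sub>i\<^sub>j \<chi>\<^sub>i(k)|\<^sup>2 = 1\<close> for every \<open>i\<close>, these sites sum to 1 one after the other, starting
  from the last.  What is left is the sum over closed paths of length \<open>N\<close>, which is the trace.
\<close>

section \<open>Path amplitudes and sums over lists of fixed length\<close>

text \<open>\<open>is\<close> is always the whole hidden path, while \<open>ks\<close> starts at
  site \<open>M + 1\<close>. The value \<open>M = 0\<close> gives the product in the state vector
  and \<open>M = N\<close> the one in \<open>env_vector\<close>, so one recursion serves
  both.\<close>

definition path_amplitude ::
    "(nat \<Rightarrow> complex^'m^'m) \<Rightarrow> (nat \<Rightarrow> complex^'d^'m) \<Rightarrow> nat \<Rightarrow> nat \<Rightarrow> 'm list \<Rightarrow> 'd list \<Rightarrow> complex"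
  where "path_amplitude U C M n is ks =
    (\<Prod>l=M+1..n. U l $ (is ! (l - 1)) $ (is ! l) * C l $ (is ! (l - 1)) $ (ks ! (l - M - 1)))"

lemma path_amplitude_same [simp]: "path_amplitude U C n n is ks = 1"
  by (simp add: path_amplitude_def)

lemma path_amplitude_snoc:
  assumes "M \<le> n" "length is = Suc n" "length ks = n - M"
  shows "path_amplitude U C M (Suc n) (is @ [j]) (ks @ [k]) =
    path_amplitude U C M n is ks * (U (Suc n) $ (is ! n) $ j * C (Suc n) $ (is ! n) $ k)"
proof -
  have "(\<Prod>l=M+1..n. U l $ ((is @ [j]) ! (l - 1)) $ ((is @ [j]) ! l) *
          C l $ ((is @ [j]) ! (l - 1)) $ ((ks @ [k]) ! (l - M - 1)))
      = path_amplitude U C M n is ks"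
    unfolding path_amplitude_def using assms
    by (intro prod.cong) (auto simp: nth_append)
  then show ?thesis
    using assms by (simp add: path_amplitude_def nth_append)
qed

lemma sum_lists_snoc:
  "(\<Sum>xs\<in>{xs :: 'a::finite list. length xs = Suc n}. f xs)
    = (\<Sum>xs\<in>{xs. length xs = n}. \<Sum>x\<in>UNIV. f (xs @ [x]))"
proof -
  have "(\<Sum>xs\<in>{xs :: 'a list. length xs = n}. \<Sum>x\<in>UNIV. f (xs @ [x]))
      = (\<Sum>(xs, x)\<in>{xs. length xs = n} \<times> UNIV. f (xs @ [x]))"
    by (rule sum.cartesian_product)
  also have "\<dots> = (\<Sum>xs\<in>{xs. length xs = Suc n}. f xs)"
    by (rule sum.reindex_bij_witness[where i = "\<lambda>xs. (butlast xs, last xs)"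
          and j = "\<lambda>(xs, x). xs @ [x]"])
      (auto simp flip: length_0_conv)
  finally show ?thesis by simp
qed

lemma sum_lists_append:
  assumes "N \<le> n"
  shows "(\<Sum>xs\<in>{xs :: 'a::finite list. length xs = n}. f xs)
    = (\<Sum>xs\<in>{xs. length xs = N}. \<Sum>ys\<in>{ys. length ys = n - N}. f (xs @ ys))"
proof -
  have "(\<Sum>xs\<in>{xs :: 'a list. length xs = N}. \<Sum>ys\<in>{ys. length ys = n - N}. f (xs @ ys))
      = (\<Sum>(xs, ys)\<in>{xs. length xs = N} \<times> {ys. length ys = n - N}. f (xs @ ys))"
    by (rule sum.cartesian_product)
  also have "\<dots> = (\<Sum>xs\<in>{xs. length xs = n}. f xs)"
    by (rule sum.reindex_bij_witness[where i = "\<lambda>xs. (take N xs, drop N xs)"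
          and j = "\<lambda>(xs, ys). xs @ ys"])
      (use assms in auto)
  finally show ?thesis by simp
qed

section \<open>The trace of a matrix product as a sum over closed paths\<close>

text \<open>The last site of \<open>mps_product\<close> sits innermost in the fold, so a further
  site enters through the initial matrix. Associativity moves that matrix out to the right.\<close>

lemma foldr_matrix_mult:
  fixes B :: "complex^'m::finite^'m"
  shows "foldr (\<lambda>l M. A l ** M) ls B = foldr (\<lambda>l M. A l ** M) ls (mat 1) ** B"
  by (induction ls) (simp_all add: matrix_mul_assoc)

lemma mps_product_Suc:
  "mps_product U C (Suc N) ks = mps_product U C N ks ** mps_matrix U C (Suc N) (ks ! N)"
proof -
  have "mps_product U C (Suc N) ks = foldr (\<lambda>l M. mps_matrix U C l (ks ! (l - 1)) ** M)
      [1..<N+1] (mps_matrix U C (Suc N) (ks ! N))"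
    by (simp add: mps_product_def)
  then show ?thesis
    unfolding mps_product_def by (subst (asm) foldr_matrix_mult)
qed

text \<open>Expansion of a matrix product over paths from \<open>a\<close> to \<open>b\<close>, by
  splitting off the last site. The endpoint \<open>b\<close> must vary in the induction, since the
  hypothesis is used at every intermediate state \<open>c\<close>.\<close>

lemma mps_product_entry:
  fixes U :: "nat \<Rightarrow> complex^'m::finite^'m" and ks :: "'d::finite list"
  assumes "length ks = N"
  shows "mps_product U C N ks $ a $ b = (\<Sum>is\<in>{is. length is = Suc N}.
    of_bool (is ! 0 = a \<and> is ! N = b) * path_amplitude U C 0 N is ks)"
  using assms
proof (induction N arbitrary: ks b)
  case 0
  then show ?case
    by (subst sum_lists_snoc, cases "a = b")
      (auto simp: mps_product_def mat_def of_bool_def intro!: sum.neutral)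
next
  case (Suc N)
  then obtain ks' k where ks: "ks = ks' @ [k]" and len: "length ks' = N"
    by (metis length_Suc_conv_rev)
  let ?w = "\<lambda>i j. U (Suc N) $ i $ j * C (Suc N) $ i $ k"
  \<comment> \<open>The sites up to \<open>N\<close> only read positions below \<open>N\<close>,
    hence never the last symbol \<open>k\<close>.\<close>
  have "mps_product U C N ks = mps_product U C N ks'"
    unfolding mps_product_def ks
    by (intro foldr_cong) (auto simp: nth_append len)
  then have "mps_product U C (Suc N) ks $ a $ b
      = (\<Sum>c\<in>UNIV. \<Sum>is\<in>{is. length is = Suc N}.
          of_bool (is ! 0 = a \<and> is ! N = c) * path_amplitude U C 0 N is ks' * ?w c b)"
    by (simp add: mps_product_Suc matrix_matrix_mult_def Suc.IH[OF len] sum_distrib_right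
        mps_matrix_def ks nth_append len del: sum_of_bool_mult_eq)
  \<comment> \<open>The intermediate state is the endpoint of the shorter path, so only
    \<open>c = is ! N\<close> contributes.\<close>
  also have "\<dots> = (\<Sum>is\<in>{is. length is = Suc N}. \<Sum>c\<in>UNIV.
      if c = is ! N then of_bool (is ! 0 = a) * path_amplitude U C 0 N is ks' * ?w c b else 0)"
    by (subst sum.swap) (intro sum.cong, auto)
  \<comment> \<open>A sum over a new endpoint \<open>j\<close>, pinned to \<open>b\<close>, is
    introduced so that \<open>is @ [j]\<close> can run over the paths with one more vertex.\<close>
  also have "\<dots> = (\<Sum>is\<in>{is. length is = Suc N}. \<Sum>j\<in>UNIV.
      if j = b then of_bool (is ! 0 = a) * (path_amplitude U C 0 N is ks' * ?w (is ! N) j) else 0)"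
    by (simp add: mult.assoc)
  also have "\<dots> = (\<Sum>is\<in>{is. length is = Suc N}. \<Sum>j\<in>UNIV.
      of_bool ((is @ [j]) ! 0 = a \<and> (is @ [j]) ! Suc N = b) *
      path_amplitude U C 0 (Suc N) (is @ [j]) ks)"
    unfolding ks
    by (intro sum.cong refl) (auto simp: path_amplitude_snoc len nth_append)
  also have "\<dots> = (\<Sum>is\<in>{is. length is = Suc (Suc N)}.
      of_bool (is ! 0 = a \<and> is ! Suc N = b) * path_amplitude U C 0 (Suc N) is ks)"
    by (rule sum_lists_snoc[symmetric])
  finally show ?case .
qed

text \<open>Among the diagonal entries, each path counts only for \<open>a = is ! 0\<close>, and
  there only if it is closed.\<close>

lemma trace_mps_product:
  fixes U :: "nat \<Rightarrow> complex^'m::finite^'m" and ks :: "'d::finite list"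
  assumes "length ks = N"
  shows "trace (mps_product U C N ks) = (\<Sum>is\<in>{is. length is = Suc N}.
    of_bool (is ! N = is ! 0) * path_amplitude U C 0 N is ks)"
proof -
  have "trace (mps_product U C N ks) = (\<Sum>is\<in>{is. length is = Suc N}. \<Sum>a\<in>UNIV.
      if a = is ! 0 then of_bool (is ! N = a) * path_amplitude U C 0 N is ks else 0)"
    unfolding trace_def mps_product_entry[OF assms]
    by (subst sum.swap) (intro sum.cong, auto)
  then show ?thesis by simp
qed

section \<open>Orthonormality of the local amplitudes and the gauge condition\<close>

lemma unitary_matrix_rows:
  assumes "unitary_matrix M"
  shows "(\<Sum>j\<in>UNIV. M $ i $ j * cnj (M $ i' $ j)) = of_bool (i = i')"
proof -
  have "(M ** adjoint_matrix M) $ i $ i' = mat 1 $ i $ i'"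
    using assms by (simp add: unitary_matrix_def)
  then show ?thesis
    by (simp add: matrix_matrix_mult_def adjoint_matrix_def mat_def)
qed

lemma sum_mult_cnj_eq_1:
  assumes "(\<Sum>k\<in>UNIV. (cmod (c k))\<^sup>2) = 1"
  shows "(\<Sum>k\<in>UNIV. c k * cnj (c k)) = 1"
proof -
  have "(\<Sum>k\<in>UNIV. c k * cnj (c k)) = complex_of_real (\<Sum>k\<in>UNIV. (cmod (c k))\<^sup>2)"
    by (simp only: complex_norm_square of_real_sum)
  then show ?thesis using assms by simp
qed

text \<open>The double sum factors into a sum over \<open>j\<close> and one over \<open>k\<close>.
  For \<open>i \<noteq> i'\<close> the first vanishes because the rows of \<open>M\<close> are
  orthogonal; for \<open>i = i'\<close> both are 1. The gauge condition uses all pairs, the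
  contraction of the tail only the diagonal ones.\<close>

lemma sum_amplitude_mult_cnj:
  fixes M :: "complex^'m::finite^'m" and X :: "complex^'d::finite^'m"
  assumes "unitary_matrix M" "\<And>i. (\<Sum>k\<in>UNIV. (cmod (X $ i $ k))\<^sup>2) = 1"
  shows "(\<Sum>j\<in>UNIV. \<Sum>k\<in>UNIV. (M $ i $ j * X $ i $ k) * cnj (M $ i' $ j * X $ i' $ k))
    = of_bool (i = i')"
proof -
  have "(\<Sum>j\<in>UNIV. \<Sum>k\<in>UNIV. (M $ i $ j * X $ i $ k) * cnj (M $ i' $ j * X $ i' $ k))
    = (\<Sum>j\<in>UNIV. M $ i $ j * cnj (M $ i' $ j)) * (\<Sum>k\<in>UNIV. X $ i $ k * cnj (X $ i' $ k))"
    unfolding sum_product by (simp add: mult_ac)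
  then show ?thesis
    using unitary_matrix_rows[OF assms(1)] sum_mult_cnj_eq_1[OF assms(2)] by auto
qed

lemma mps_matrix_gauge:
  fixes U :: "nat \<Rightarrow> complex^'m::finite^'m" and C :: "nat \<Rightarrow> complex^'d::finite^'m"
  assumes "unitary_matrix (U n)" "\<And>i. (\<Sum>k\<in>UNIV. (cmod (C n $ i $ k))\<^sup>2) = 1"
  shows "(\<Sum>k\<in>UNIV. mps_matrix U C n k ** adjoint_matrix (mps_matrix U C n k)) = mat 1"
proof -
  have "(\<Sum>k\<in>UNIV. mps_matrix U C n k ** adjoint_matrix (mps_matrix U C n k)) $ i $ i'
      = (\<Sum>j\<in>UNIV. \<Sum>k\<in>UNIV.
          (U n $ i $ j * C n $ i $ k) * cnj (U n $ i' $ j * C n $ i' $ k))" for i i'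
    unfolding sum_component matrix_matrix_mult_def mps_matrix_def adjoint_matrix_def
    by (subst sum.swap) simp
  then show ?thesis
    unfolding sum_amplitude_mult_cnj[OF assms]
    by (simp add: vec_eq_iff mat_def)
qed

section \<open>Contraction of the sites after \<open>N\<close>\<close>

text \<open>In the step from \<open>n\<close> to \<open>Suc n\<close> the new vertex and the new
  symbol occur only in the factor of the last site, which therefore sums to 1 separately. The
  closing condition looks only at positions \<open>0\<close> and \<open>N\<close> and is left
  intact.\<close>

lemma tail_contraction:
  fixes U :: "nat \<Rightarrow> complex^'m::finite^'m" and C :: "nat \<Rightarrow> complex^'d::finite^'m"
  assumes U: "\<And>n. n \<ge> 1 \<Longrightarrow> unitary_matrix (U n)"
    and C: "\<And>n i. n \<ge> 1 \<Longrightarrow> (\<Sum>k\<in>UNIV. (cmod (C n $ i $ k))\<^sup>2) = 1"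
    and "N \<le> n" "length ks = N"
  shows "(\<Sum>is\<in>{is. length is = Suc n}. \<Sum>ks'\<in>{ks'. length ks' = n - N}.
      of_bool (is ! N = is ! 0) *
      (path_amplitude U C 0 n is (ks @ ks') * cnj (path_amplitude U C N n is ks')))
    = (\<Sum>is\<in>{is. length is = Suc N}. of_bool (is ! N = is ! 0) * path_amplitude U C 0 N is ks)"
  using \<open>N \<le> n\<close>
proof (induction n rule: dec_induct)
  case base
  show ?case by simp
next
  case (step n)
  let ?t = "\<lambda>n is ks'. of_bool (is ! N = is ! 0) *
      (path_amplitude U C 0 n is (ks @ ks') * cnj (path_amplitude U C N n is ks'))"
  let ?w = "\<lambda>i j k. U (Suc n) $ i $ j * C (Suc n) $ i $ k"
  have snoc: "?t (Suc n) (is @ [j]) (ks' @ [k])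
      = ?t n is ks' * (?w (is ! n) j k * cnj (?w (is ! n) j k))"
    if "length is = Suc n" "length ks' = n - N" for "is" ks' j k
  proof -
    have "path_amplitude U C 0 (Suc n) (is @ [j]) (ks @ ks' @ [k])
        = path_amplitude U C 0 n is (ks @ ks') * ?w (is ! n) j k"
      using path_amplitude_snoc[of 0 n "is" "ks @ ks'" U C j k] that step assms(4) by simp
    moreover have "path_amplitude U C N (Suc n) (is @ [j]) (ks' @ [k])
        = path_amplitude U C N n is ks' * ?w (is ! n) j k"
      using path_amplitude_snoc[of N n "is" ks' U C j k] that step by simp
    \<comment> \<open>As \<open>N \<le> n\<close>, position \<open>N\<close> lies within the old
      path, even for \<open>n = N\<close>.\<close>
    moreover have "(is @ [j]) ! N = is ! N" "(is @ [j]) ! 0 = is ! 0"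
      using that step by (simp_all add: nth_append)
    ultimately show ?thesis by (simp only: complex_cnj_mult mult_ac)
  qed
  have "(\<Sum>is\<in>{is. length is = Suc (Suc n)}. \<Sum>ks'\<in>{ks'. length ks' = Suc n - N}. ?t (Suc n) is ks')
      = (\<Sum>is\<in>{is. length is = Suc n}. \<Sum>j\<in>UNIV. \<Sum>ks'\<in>{ks'. length ks' = n - N}. \<Sum>k\<in>UNIV.
          ?t (Suc n) (is @ [j]) (ks' @ [k]))"
    using step by (simp only: Suc_diff_le sum_lists_snoc)
  \<comment> \<open>Moving the sum over \<open>j\<close> inside puts it next to the sum over
    \<open>k\<close>, where the local normalisation applies.\<close>
  also have "\<dots> = (\<Sum>is\<in>{is. length is = Suc n}. \<Sum>ks'\<in>{ks'. length ks' = n - N}.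
      \<Sum>j\<in>UNIV. \<Sum>k\<in>UNIV. ?t (Suc n) (is @ [j]) (ks' @ [k]))"
    by (intro sum.cong refl sum.swap)
  also have "\<dots> = (\<Sum>is\<in>{is. length is = Suc n}. \<Sum>ks'\<in>{ks'. length ks' = n - N}.
      ?t n is ks' * (\<Sum>j\<in>UNIV. \<Sum>k\<in>UNIV. ?w (is ! n) j k * cnj (?w (is ! n) j k)))"
    unfolding sum_distrib_left by (intro sum.cong refl snoc) auto
  also have "\<dots> = (\<Sum>is\<in>{is. length is = Suc n}. \<Sum>ks'\<in>{ks'. length ks' = n - N}. ?t n is ks')"
    by (subst sum_amplitude_mult_cnj) (use U C in auto)
  finally show ?case using step.IH by simp
qed

section \<open>The partial inner product in coordinates\<close>

text \<open>On a basis ket the contraction leaves \<open>ket (take N ks)\<close> with the conjugated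
  coordinate of \<open>u\<close> at \<open>(is, drop N ks)\<close>. Cutting each \<open>ks\<close>
  at \<open>N\<close> collects the terms by surviving ket.\<close>

lemma partial_inner_split_sites:
  fixes f :: "'m::finite list \<Rightarrow> 'd::finite list \<Rightarrow> complex"
  assumes "N \<le> n"
  shows "partial_inner (split_sites N (\<Sum>is\<in>{is. length is = a}. \<Sum>ks\<in>{ks. length ks = n}.
      f is ks \<cdot>\<^sub>C (ket is \<otimes>\<^sub>C ket ks))) u
    = (\<Sum>ks\<in>{ks. length ks = N}. (\<Sum>is\<in>{is. length is = a}. \<Sum>ks'\<in>{ks'. length ks' = n - N}.
        f is (ks @ ks') * cnj (Poly_Mapping.lookup u (is, ks'))) \<cdot>\<^sub>C ket ks)"
    (is "?l = ?r")
proof -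
  have cinner_ket: "cinner (ket x) u = cnj (Poly_Mapping.lookup u x)" for x
    by (simp add: cinner_def ket_def)
  have "?l = (\<Sum>is\<in>{is. length is = a}. \<Sum>ks\<in>{ks. length ks = n}.
      f is ks \<cdot>\<^sub>C cnj (Poly_Mapping.lookup u (is, drop N ks)) \<cdot>\<^sub>C ket (take N ks))"
    by (simp add: split_sites_def partial_inner_def lin_ext_sum lin_ext_scale tensor_ket_ket
        cinner_ket)
  also have "\<dots> = (\<Sum>is\<in>{is. length is = a}. \<Sum>ks\<in>{ks. length ks = N}.
      \<Sum>ks'\<in>{ks'. length ks' = n - N}.
      f is (ks @ ks') \<cdot>\<^sub>C cnj (Poly_Mapping.lookup u (is, ks')) \<cdot>\<^sub>C ket ks)"
    unfolding sum_lists_append[OF assms] by (intro sum.cong refl) auto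
  also have "\<dots> = (\<Sum>ks\<in>{ks. length ks = N}. \<Sum>is\<in>{is. length is = a}.
      \<Sum>ks'\<in>{ks'. length ks' = n - N}.
      f is (ks @ ks') \<cdot>\<^sub>C cnj (Poly_Mapping.lookup u (is, ks')) \<cdot>\<^sub>C ket ks)"
    by (rule sum.swap)
  also have "\<dots> = ?r"
    by (rule poly_mapping_eqI) (simp add: lookup_sum sum_distrib_right mult.assoc)
  finally show ?thesis .
qed

text \<open>All tensor powers share one type, so lying in the right one is a separate claim:
  coordinates at lists of any other length vanish.\<close>

lemma sum_kets_in_tensor_power:
  "(\<Sum>ks\<in>{ks :: 'd::finite list. length ks = N}. g ks \<cdot>\<^sub>C ket ks) \<in> tensor_power N"
proof -
  have "Poly_Mapping.lookup (\<Sum>ks\<in>{ks :: 'd list. length ks = N}. g ks \<cdot>\<^sub>C ket ks) xs = 0"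
    if "length xs \<noteq> N" for xs
    using that by (auto simp: lookup_sum lookup_ket intro!: sum.neutral)
  then show ?thesis
    by (auto simp: tensor_power_def in_keys_iff)
qed

lemma lookup_env_vector:
  "Poly_Mapping.lookup (env_vector p U C N n) (is, ks) =
    (if length is = n + 1 \<and> length ks = n - N then
       complex_of_real (1 / sqrt (p (is ! 0))) * path_amplitude U C N n is ks *
       of_bool (is ! N = is ! 0)
     else 0)"
  unfolding env_vector_def path_amplitude_def by (rule lookup_sum_tensor_kets)

lemma partial_inner_ehmm_state_env_vector:
  fixes p :: "'m::finite \<Rightarrow> real"
    and U :: "nat \<Rightarrow> complex^'m^'m"
    and C :: "nat \<Rightarrow> complex^'d::finite^'m"
  assumes p: "\<And>i. p i > 0"
    and U: "\<And>n. n \<ge> 1 \<Longrightarrow> unitary_matrix (U n)"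
    and C: "\<And>n i. n \<ge> 1 \<Longrightarrow> (\<Sum>k\<in>UNIV. (cmod (C n $ i $ k))\<^sup>2) = 1"
    and N: "N \<le> n"
  shows "partial_inner (split_sites N (ehmm_state p U C n)) (env_vector p U C N n)
    = (\<Sum>ks\<in>{ks. length ks = N}. trace (mps_product U C N ks) \<cdot>\<^sub>C ket ks)"
proof -
  have state: "ehmm_state p U C n = (\<Sum>is\<in>{is. length is = n + 1}. \<Sum>ks\<in>{ks. length ks = n}.
      (complex_of_real (sqrt (p (is ! 0))) * path_amplitude U C 0 n is ks)
      \<cdot>\<^sub>C (ket is \<otimes>\<^sub>C ket ks))"
    by (simp add: ehmm_state_def path_amplitude_def)
  \<comment> \<open>Positivity of \<open>p i\<close> matters here: at 0 the product would be 0,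
    since \<open>1 / 0 = 0\<close>.\<close>
  have cancel: "complex_of_real (sqrt (p i)) * complex_of_real (1 / sqrt (p i)) = 1" for i
    using p[of i] by (simp flip: of_real_mult)
  have "(\<Sum>is\<in>{is. length is = n + 1}. \<Sum>ks'\<in>{ks'. length ks' = n - N}.
      complex_of_real (sqrt (p (is ! 0))) * path_amplitude U C 0 n is (ks @ ks') *
      cnj (Poly_Mapping.lookup (env_vector p U C N n) (is, ks')))
    = trace (mps_product U C N ks)" (is "?c = _") if "length ks = N" for ks
  proof -
    \<comment> \<open>Conjugation fixes the real factor \<open>1 / sqrt (p (is ! 0))\<close> and the
      indicator, so it acts only on the tail amplitude.\<close>
    have "?c = (\<Sum>is\<in>{is. length is = Suc n}. \<Sum>ks'\<in>{ks'. length ks' = n - N}.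
        (complex_of_real (sqrt (p (is ! 0))) * complex_of_real (1 / sqrt (p (is ! 0)))) *
        (of_bool (is ! N = is ! 0) *
        (path_amplitude U C 0 n is (ks @ ks') * cnj (path_amplitude U C N n is ks'))))"
      by (intro sum.cong) (auto simp: lookup_env_vector)
    then show ?thesis
      by (simp only: cancel mult_1 tail_contraction[OF U C N that] trace_mps_product[OF that])
  qed
  then show ?thesis
    unfolding state partial_inner_split_sites[OF N] by (intro sum.cong) auto
qed

theorem theorem3p1:
  fixes p :: "'m::finite \<Rightarrow> real"
    and U :: "nat \<Rightarrow> complex^'m^'m"
    and C :: "nat \<Rightarrow> complex^'d::finite^'m"
  assumes "\<And>i. p i > 0"
    and "(\<Sum>i\<in>UNIV. p i) = 1"
    and "\<And>n. n \<ge> 1 \<Longrightarrow> unitary_matrix (U n)"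
    and "\<And>n i. n \<ge> 1 \<Longrightarrow> (\<Sum>k\<in>UNIV. (cmod (C n $ i $ k))\<^sup>2) = 1"
  shows "(\<forall>N\<ge>1. \<forall>n\<ge>N.
            partial_inner (split_sites N (ehmm_state p U C n)) (env_vector p U C N n)
              = (\<Sum>ks\<in>{ks. length ks = N}. trace (mps_product U C N ks) \<cdot>\<^sub>C ket ks) \<and>
            partial_inner (split_sites N (ehmm_state p U C n)) (env_vector p U C N n)
              \<in> tensor_power N) \<and>
         (\<forall>n\<ge>1. (\<Sum>k\<in>UNIV. mps_matrix U C n k ** adjoint_matrix (mps_matrix U C n k)) = mat 1)"
proof (intro conjI allI impI)
  fix N n :: nat
  assume "N \<le> n"
  then show eq: "partial_inner (split_sites N (ehmm_state p U C n)) (env_vector p U C N n)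
      = (\<Sum>ks\<in>{ks. length ks = N}. trace (mps_product U C N ks) \<cdot>\<^sub>C ket ks)"
    using assms by (intro partial_inner_ehmm_state_env_vector) auto
  show "partial_inner (split_sites N (ehmm_state p U C n)) (env_vector p U C N n) \<in> tensor_power N"
    unfolding eq by (rule sum_kets_in_tensor_power)
next
  fix n :: nat
  assume "1 \<le> n"
  then show "(\<Sum>k\<in>UNIV. mps_matrix U C n k ** adjoint_matrix (mps_matrix U C n k)) = mat 1"
    using assms by (intro mps_matrix_gauge) auto
qed

end
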